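(* Let $X$ be a diffeological space such that the free diffeological vector space $F(X)$ generated by $X$ is a fine diffeological vector space. Then $X$ is discrete.
   Context: A diffeological space is a set $X$ together with a specified set of functions $U\to X$ (called plots), for every open set $U\subseteq\mathbb{R}^n$ and every $n\in\mathbb{N}=\{0,1,2,\dots\}$, such that: (1) every constant map $U\to X$ is a plot; (2) if $U\to X$ is a plot and $V\to U$ is a smooth map between open subsets of Euclidean spaces, then $V\to U\to X$ is a plot; (3) if $U=\bigcup_i U_i$ is an open cover and $U\to X$ is a map whose restrictions to all $U_i$ are plots, then $U\to X$ is a plot. A map between diffeological spaces is smooth if composing with it sends plots to plots. A diffeological space is discrete if its plots are exactly the locally constant maps. Products carry the product diffeology (a map into a product is a plot iff all its components are plots), and $\mathbb{R}$ carries the standard diffeology. A diffeological vector space is a real vector space $V$ with a diffeology such that addition $V\times V\to V$ and scalar multiplication $\mathbb{R}\times V\to V$ are smooth. For a diffeological space $X$, the free diffeological vector space $F(X)$ generated by $X$ is the free real vector space on the underlying set of $X$ (basis elements written $[x]$), with the diffeology generated by all maps $\mathbb{R}\times U_1\times\cdots\times\mathbb{R}\times U_n\to F(X)$, $(r_1,u_1,\dots,r_n,u_n)\mapsto r_1[p_1(u_1)]+\cdots+r_n[p_n(u_n)]$, for all $n\ge 1$ and all plots $p_i:U_i\to X$; it is the smallest diffeology making $F(X)$ a diffeological vector space and $X\to F(X)$, $x\mapsto[x]$, smooth. The fine diffeology on a real vector space $V$ is the smallest diffeology making $V$ a diffeological vector space; it is the diffeology generated by all linear maps $\mathbb{R}^n\to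 V$, $n\in\mathbb{N}$ (i.e. plots are the maps which locally have the form $l\circ f$ with $f$ smooth into some $\mathbb{R}^n$ and $l:\mathbb{R}^n\to V$ linear). A fine diffeological vector space is a vector space with the fine diffeology. *)

theory Defs
  imports "HOL-Analysis.Analysis" "HOL-Analysis.Finite_Function_Topology"
begin

section \<open>Smooth maps between open subsets of Euclidean spaces\<close>

text \<open>
  Throughout, \<open>\<real>\<^sup>n\<close> is the library's \<^term>\<open>Euclidean_space n\<close>: the sequences \<open>x :: nat \<Rightarrow> real\<close>
  with \<open>x i = 0\<close> for \<open>i \<ge> n\<close>, with coordinates \<open>x 0, \<dots>, x (n - 1)\<close>. This makes the dimension
  \<open>n\<close> (including \<open>n = 0\<close>) an ordinary bound variable.
\<close>

text \<open>
  Real-valued \<open>C\<^sup>k\<close> functions on an open \<open>U \<subseteq> \<real>\<^sup>n\<close>, by iterated continuous partial derivatives.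
  As \<open>U\<close> is open and \<open>i < n\<close>, the values of \<open>f\<close> outside \<open>U\<close> play no role.
\<close>

primrec Ck_function :: "nat \<Rightarrow> nat \<Rightarrow> (nat \<Rightarrow> real) set \<Rightarrow> ((nat \<Rightarrow> real) \<Rightarrow> real) \<Rightarrow> bool" where
  "Ck_function 0 n U f \<longleftrightarrow> continuous_map (subtopology (Euclidean_space n) U) euclideanreal f"
| "Ck_function (Suc k) n U f \<longleftrightarrow>
     continuous_map (subtopology (Euclidean_space n) U) euclideanreal f \<and>
     (\<forall>i<n. \<exists>f'. (\<forall>x\<in>U. ((\<lambda>t. f (x(i := t))) has_real_derivative f' x) (at (x i))) \<and>
                 Ck_function k n U f')"

definition smooth_function :: "nat \<Rightarrow> (nat \<Rightarrow> real) set \<Rightarrow> ((nat \<Rightarrow> real) \<Rightarrow> real) \<Rightarrow> bool" where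
  "smooth_function n U f \<longleftrightarrow> (\<forall>k. Ck_function k n U f)"

definition smooth_euclidean_map ::
  "nat \<Rightarrow> (nat \<Rightarrow> real) set \<Rightarrow> nat \<Rightarrow> (nat \<Rightarrow> real) set \<Rightarrow> ((nat \<Rightarrow> real) \<Rightarrow> nat \<Rightarrow> real) \<Rightarrow> bool" where
  "smooth_euclidean_map m V n U f \<longleftrightarrow>
     f \<in> V \<rightarrow> U \<and> (\<forall>i<n. smooth_function m V (\<lambda>x. f x i))"


section \<open>Diffeological spaces\<close>

text \<open>
  \<open>D n U\<close> is the set of plots \<open>U \<rightarrow> X\<close> with \<open>U\<close> open in \<open>\<real>\<^sup>n\<close>. A function \<open>U \<rightarrow> X\<close> is represented by
  the element of \<^term>\<open>U \<rightarrow>\<^sub>E X\<close>, which is \<^term>\<open>undefined\<close> outside \<open>U\<close>, so equality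
  of diffeologies is the equality of HOL, and \<open>D \<le> E\<close> says that every plot of \<open>D\<close> is a plot of \<open>E\<close>.
\<close>

type_synonym 'a diffeology = "nat \<Rightarrow> (nat \<Rightarrow> real) set \<Rightarrow> ((nat \<Rightarrow> real) \<Rightarrow> 'a) set"

definition diffeological_space :: "'a set \<Rightarrow> 'a diffeology \<Rightarrow> bool" where
  "diffeological_space X D \<longleftrightarrow>
     (\<forall>n U p. p \<in> D n U \<longrightarrow> openin (Euclidean_space n) U \<and> p \<in> U \<rightarrow>\<^sub>E X) \<and>
     (\<forall>n U x. openin (Euclidean_space n) U \<and> x \<in> X \<longrightarrow> (\<lambda>u\<in>U. x) \<in> D n U) \<and>
     (\<forall>n U p m V f. p \<in> D n U \<and> openin (Euclidean_space m) V \<and> smooth_euclidean_map m V n U f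
        \<longrightarrow> restrict (p \<circ> f) V \<in> D m V) \<and>
     (\<forall>n \<U> p. (\<forall>U\<in>\<U>. openin (Euclidean_space n) U \<and> restrict p U \<in> D n U) \<and> p \<in> \<Union>\<U> \<rightarrow>\<^sub>E X
        \<longrightarrow> p \<in> D n (\<Union>\<U>))"

definition diffeological_smooth ::
  "'a set \<Rightarrow> 'a diffeology \<Rightarrow> 'b set \<Rightarrow> 'b diffeology \<Rightarrow> ('a \<Rightarrow> 'b) \<Rightarrow> bool" where
  "diffeological_smooth X D Y E f \<longleftrightarrow>
     f \<in> X \<rightarrow> Y \<and> (\<forall>n U p. p \<in> D n U \<longrightarrow> restrict (f \<circ> p) U \<in> E n U)"

definition discrete_diffeology :: "'a set \<Rightarrow> 'a diffeology" where
  "discrete_diffeology X n U =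
     {p \<in> U \<rightarrow>\<^sub>E X. openin (Euclidean_space n) U \<and>
        (\<forall>u\<in>U. \<exists>V. openin (Euclidean_space n) V \<and> u \<in> V \<and> V \<subseteq> U \<and> p constant_on V)}"

definition prod_diffeology :: "'a diffeology \<Rightarrow> 'b diffeology \<Rightarrow> ('a \<times> 'b) diffeology" where
  "prod_diffeology D E n U =
     {p \<in> extensional U. restrict (fst \<circ> p) U \<in> D n U \<and> restrict (snd \<circ> p) U \<in> E n U}"

definition real_diffeology :: "real diffeology" where
  "real_diffeology n U =
     {f \<in> extensional U. openin (Euclidean_space n) U \<and> smooth_function n U f}"

text \<open>The smallest diffeology on \<open>X\<close> containing a family \<open>G\<close> of maps from Euclidean open sets to \<open>X\<close>.\<close>

definition generated_diffeology :: "'a set \<Rightarrow> 'a diffeology \<Rightarrow> 'a diffeology" where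
  "generated_diffeology X G = Inf {E. diffeological_space X E \<and> G \<le> E}"


section \<open>Diffeological vector spaces\<close>

text \<open>
  A real vector space is a linear subspace \<open>V\<close> (possibly all) of a type of class
  \<^class>\<open>real_vector\<close>.
\<close>

definition diffeological_vector_space :: "'v::real_vector set \<Rightarrow> 'v diffeology \<Rightarrow> bool" where
  "diffeological_vector_space V D \<longleftrightarrow>
     subspace V \<and> diffeological_space V D \<and>
     diffeological_smooth (V \<times> V) (prod_diffeology D D) V D (\<lambda>(v, w). v + w) \<and>
     diffeological_smooth (UNIV \<times> V) (prod_diffeology real_diffeology D) V D (\<lambda>(r, v). r *\<^sub>R v)"

definition fine_vector_space :: "'v::real_vector set \<Rightarrow> 'v diffeology \<Rightarrow> bool" where
  "fine_vector_space V D \<longleftrightarrow>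
     diffeological_vector_space V D \<and> (\<forall>E. diffeological_vector_space V E \<longrightarrow> D \<le> E)"


section \<open>The free diffeological vector space\<close>

text \<open>
  Finitely supported functions supported in \<open>X\<close>; the basis element \<open>[x]\<close> is
  \<^term>\<open>Poly_Mapping.single x (1::real)\<close>, and \<open>r[x]\<close> is \<^term>\<open>Poly_Mapping.single x (r::real)\<close>.
  Only the vector space structure of the type is used, not the norm it carries in the library.
\<close>

definition free_vector_space :: "'a set \<Rightarrow> ('a \<Rightarrow>\<^sub>0 real) set" where
  "free_vector_space X = {v. Poly_Mapping.keys v \<subseteq> X}"

text \<open>
  For \<open>U\<^sub>i \<subseteq> \<real>\<^bsup>k i\<^esup>\<close>, \<open>i < n\<close>, the product \<open>\<real> \<times> U\<^sub>0 \<times> \<dots> \<times> \<real> \<times> U\<^bsub>n-1\<^esub>\<close> is an open subset of \<open>\<real>\<^sup>N\<close>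
  with \<open>N = block_start k n\<close>: the coordinate \<open>r\<^sub>i\<close> of a point \<open>x\<close> is \<open>x (block_start k i)\<close>, and the
  next \<open>k i\<close> coordinates form \<open>u\<^sub>i = block k i x\<close>.
\<close>

definition block_start :: "(nat \<Rightarrow> nat) \<Rightarrow> nat \<Rightarrow> nat" where
  "block_start k i = (\<Sum>j<i. 1 + k j)"

definition block :: "(nat \<Rightarrow> nat) \<Rightarrow> nat \<Rightarrow> (nat \<Rightarrow> real) \<Rightarrow> nat \<Rightarrow> real" where
  "block k i x = (\<lambda>j. if j < k i then x (block_start k i + 1 + j) else 0)"

definition free_domain :: "nat \<Rightarrow> (nat \<Rightarrow> nat) \<Rightarrow> (nat \<Rightarrow> (nat \<Rightarrow> real) set) \<Rightarrow> (nat \<Rightarrow> real) set" where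
  "free_domain n k U = {x \<in> topspace (Euclidean_space (block_start k n)). \<forall>i<n. block k i x \<in> U i}"

definition free_generators :: "'a diffeology \<Rightarrow> ('a \<Rightarrow>\<^sub>0 real) diffeology" where
  "free_generators D N W =
     {g. \<exists>n k U p. 1 \<le> n \<and> (\<forall>i<n. p i \<in> D (k i) (U i)) \<and>
          N = block_start k n \<and> W = free_domain n k U \<and>
          g = (\<lambda>x\<in>W. \<Sum>i<n. Poly_Mapping.single (p i (block k i x)) (x (block_start k i)))}"

definition free_diffeology :: "'a set \<Rightarrow> 'a diffeology \<Rightarrow> ('a \<Rightarrow>\<^sub>0 real) diffeology" where
  "free_diffeology X D = generated_diffeology (free_vector_space X) (free_generators D)"

end

theory Submission
  imports Defs
begin

text \<open>
  The maps into \<open>F(X)\<close> whose coordinates are all continuous form a vector space diffeology, so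
  they include every plot of the fine diffeology. If \<open>F(X)\<close> is fine and \<open>p\<close> is a plot of \<open>X\<close>, then
  \<open>u \<mapsto> [p(u)]\<close> is such a map. Its coordinate at \<open>x\<close> is the indicator function of the fibre of \<open>p\<close>
  over \<open>x\<close>; as this is continuous, all fibres are open and \<open>p\<close> is locally constant.
\<close>

section \<open>Smooth maps between Euclidean open sets are continuous\<close>

lemma Ck_function_const: "Ck_function k n U (\<lambda>x. c)"
\<comment> \<open>\<open>c\<close> is generalised because the partial derivatives are again
  constant, but with value 0.\<close>
proof (induction k arbitrary: c)
  case (Suc k)
  then show ?case
    by (auto intro!: exI[of _ "\<lambda>x. 0"] derivative_eq_intros)
qed simp

lemma continuous_map_Euclidean_space_coordinate:
  "continuous_map (subtopology (Euclidean_space n) U) euclideanreal (\<lambda>x. x j)"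
  unfolding Euclidean_space_def
  by (intro continuous_map_from_subtopology continuous_map_product_projection) simp

text \<open>The partial derivatives are the constants 0 and 1, so a case distinction on
  \<open>k\<close> replaces an induction.\<close>

lemma Ck_function_coordinate: "Ck_function k n U (\<lambda>x. x j)"
proof (cases k)
  case 0
  then show ?thesis
    using continuous_map_Euclidean_space_coordinate by simp
next
  case (Suc k')
  have "\<exists>f'. (\<forall>x\<in>U. ((\<lambda>t. (x(i := t)) j) has_real_derivative f' x) (at (x i))) \<and>
      Ck_function k' n U f'" for i
  proof (intro exI conjI ballI)
    show "((\<lambda>t. (x(i := t)) j) has_real_derivative (if j = i then 1 else 0)) (at (x i))" for x
      by (cases "j = i") auto
  qed (rule Ck_function_const)
  then show ?thesis
    by (simp only: Suc Ck_function.simps continuous_map_Euclidean_space_coordinate simp_thms)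
qed

lemma smooth_function_imp_continuous_map:
  "smooth_function n U f \<Longrightarrow> continuous_map (subtopology (Euclidean_space n) U) euclideanreal f"
  unfolding smooth_function_def by (metis Ck_function.simps(1))

text \<open>\<open>Euclidean_space n\<close> carries the topology induced from a product, so
  continuity is checked on each coordinate. Smoothness settles those below \<open>n\<close>; the
  others vanish on \<open>V\<close>, since \<open>f\<close> takes values in a subset of
  \<open>\<real>\<^sup>n\<close>.\<close>

lemma smooth_euclidean_map_imp_continuous_map:
  assumes "smooth_euclidean_map m V n U f" and U: "openin (Euclidean_space n) U"
  shows "continuous_map (subtopology (Euclidean_space m) V) (subtopology (Euclidean_space n) U) f"
proof -
  have f: "f \<in> V \<rightarrow> U"
    and cont: "\<And>i. i < n \<Longrightarrow>
      continuous_map (subtopology (Euclidean_space m) V) euclideanreal (\<lambda>x. f x i)"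
    using assms smooth_function_imp_continuous_map by (auto simp: smooth_euclidean_map_def)
  have zero: "f x i = 0" if "x \<in> V" "n \<le> i" for x i
    using f openin_subset[OF U] that by (auto simp: topspace_Euclidean_space)
  have "continuous_map (subtopology (Euclidean_space m) V) euclideanreal (\<lambda>x. f x i)" for i
  proof (cases "i < n")
    case False
    have "continuous_map (subtopology (Euclidean_space m) V) euclideanreal (\<lambda>x. 0)"
      by simp
    then show ?thesis
      by (rule continuous_map_eq) (use False zero in auto)
  qed (rule cont)
  then show ?thesis
    using f zero
    by (auto simp: continuous_map_in_subtopology Euclidean_space_def continuous_map_componentwise_UNIV)
qed

section \<open>The vector space diffeology of maps with continuous coordinates\<close>

text \<open>Continuity is asked for instead of smoothness: it is enough to make fibres open in the
  end, and its closure properties involve neither chain rule nor product rule.\<close>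

definition coordinatewise_diffeology :: "'a set \<Rightarrow> ('a \<Rightarrow>\<^sub>0 real) diffeology" where
  "coordinatewise_diffeology X n U =
     {p \<in> U \<rightarrow>\<^sub>E free_vector_space X. openin (Euclidean_space n) U \<and>
        (\<forall>x. continuous_map (subtopology (Euclidean_space n) U) euclideanreal
               (\<lambda>u. Poly_Mapping.lookup (p u) x))}"

lemma diffeological_space_coordinatewise:
  "diffeological_space (free_vector_space X) (coordinatewise_diffeology X)"
  unfolding diffeological_space_def
proof (intro conjI allI impI)
  fix n U and p :: "(nat \<Rightarrow> real) \<Rightarrow> 'a \<Rightarrow>\<^sub>0 real"
  assume "p \<in> coordinatewise_diffeology X n U"
  then show "openin (Euclidean_space n) U" "p \<in> U \<rightarrow>\<^sub>E free_vector_space X"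
    by (auto simp: coordinatewise_diffeology_def)
next
  fix n U and v :: "'a \<Rightarrow>\<^sub>0 real"
  assume "openin (Euclidean_space n) U \<and> v \<in> free_vector_space X"
  moreover have "continuous_map (subtopology (Euclidean_space n) U) euclideanreal
      (\<lambda>u. Poly_Mapping.lookup ((\<lambda>u\<in>U. v) u) x)" for x
    \<comment> \<open>Maps are \<open>undefined\<close> off \<open>U\<close>, so continuity is
      transferred from an unrestricted map that agrees on \<open>U\<close>.\<close>
    by (rule continuous_map_eq[where f = "\<lambda>u. Poly_Mapping.lookup v x"]) auto
  ultimately show "(\<lambda>u\<in>U. v) \<in> coordinatewise_diffeology X n U"
    by (auto simp: coordinatewise_diffeology_def)
next
  fix n U m V f and p :: "(nat \<Rightarrow> real) \<Rightarrow> 'a \<Rightarrow>\<^sub>0 real"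
  assume asm: "p \<in> coordinatewise_diffeology X n U \<and> openin (Euclidean_space m) V \<and>
    smooth_euclidean_map m V n U f"
  then have p: "p \<in> U \<rightarrow>\<^sub>E free_vector_space X" "openin (Euclidean_space n) U"
    "\<And>x. continuous_map (subtopology (Euclidean_space n) U) euclideanreal
       (\<lambda>u. Poly_Mapping.lookup (p u) x)"
    by (auto simp: coordinatewise_diffeology_def)
  have f: "f \<in> V \<rightarrow> U"
    "continuous_map (subtopology (Euclidean_space m) V) (subtopology (Euclidean_space n) U) f"
    using asm p smooth_euclidean_map_imp_continuous_map by (auto simp: smooth_euclidean_map_def)
  have "continuous_map (subtopology (Euclidean_space m) V) euclideanreal
      (\<lambda>u. Poly_Mapping.lookup (restrict (p \<circ> f) V u) x)" for x
    by (rule continuous_map_eq[OF continuous_map_compose[OF f(2) p(3)[of x]]]) auto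
  with asm p f show "restrict (p \<circ> f) V \<in> coordinatewise_diffeology X m V"
    by (auto simp: coordinatewise_diffeology_def)
next
  fix n \<U> and p :: "(nat \<Rightarrow> real) \<Rightarrow> 'a \<Rightarrow>\<^sub>0 real"
  assume asm: "(\<forall>U\<in>\<U>. openin (Euclidean_space n) U \<and>
      restrict p U \<in> coordinatewise_diffeology X n U) \<and> p \<in> \<Union>\<U> \<rightarrow>\<^sub>E free_vector_space X"
  have "continuous_map (subtopology (Euclidean_space n) (\<Union>\<U>)) euclideanreal
      (\<lambda>u. Poly_Mapping.lookup (p u) x)" for x
  \<comment> \<open>The cover is indexed by itself, and all the local functions to be glued are the
    same one.\<close>
  proof (rule pasting_lemma[where I = \<U> and T = "\<lambda>U. U" and f = "\<lambda>U u. Poly_Mapping.lookup (p u) x"])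
    fix U assume U: "U \<in> \<U>"
    show "openin (subtopology (Euclidean_space n) (\<Union>\<U>)) U"
      using openin_subtopology_Int[of "Euclidean_space n" U "\<Union>\<U>"] asm U
      by (simp add: Int_absorb2 Union_upper)
    have "continuous_map (subtopology (Euclidean_space n) U) euclideanreal
        (\<lambda>u. Poly_Mapping.lookup (restrict p U u) x)"
      using asm U by (auto simp: coordinatewise_diffeology_def)
    then have "continuous_map (subtopology (Euclidean_space n) U) euclideanreal
        (\<lambda>u. Poly_Mapping.lookup (p u) x)"
      by (rule continuous_map_eq) auto
    moreover have "\<Union>\<U> \<inter> U = U"
      using U by auto
    ultimately show "continuous_map (subtopology (subtopology (Euclidean_space n) (\<Union>\<U>)) U)
        euclideanreal (\<lambda>u. Poly_Mapping.lookup (p u) x)"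
      by (simp add: subtopology_subtopology)
  qed auto
  with asm show "p \<in> coordinatewise_diffeology X n (\<Union>\<U>)"
    by (auto simp: coordinatewise_diffeology_def)
qed

lemma lookup_scaleR: "Poly_Mapping.lookup (r *\<^sub>R v) x = r * Poly_Mapping.lookup v x"
proof -
  \<comment> \<open>\<open>scaleR\<close> is defined through \<open>Abs_poly_mapping\<close>, whose
    evaluation needs finite support.\<close>
  have "finite {x. r * Poly_Mapping.lookup v x \<noteq> 0}"
    by (rule finite_subset[OF _ finite_lookup[of v]]) auto
  then show ?thesis
    by (simp add: scaleR_poly_mapping_def)
qed

text \<open>This bounds the fine diffeology from above. It holds because the operations of
  \<open>F(X)\<close> act on each coordinate separately and sums and products of continuous real
  functions are continuous.\<close>

lemma diffeological_vector_space_coordinatewise: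
  "diffeological_vector_space (free_vector_space X) (coordinatewise_diffeology X)"
  unfolding diffeological_vector_space_def
proof (intro conjI diffeological_space_coordinatewise)
  show sub: "subspace (free_vector_space X)"
  proof (rule subspaceI)
    fix v w :: "'a \<Rightarrow>\<^sub>0 real" and r
    assume v: "v \<in> free_vector_space X"
    then show "r *\<^sub>R v \<in> free_vector_space X"
      by (auto simp: free_vector_space_def in_keys_iff lookup_scaleR subset_iff)
    assume "w \<in> free_vector_space X"
    then show "v + w \<in> free_vector_space X"
      using v keys_add[of v w] by (auto simp: free_vector_space_def)
  qed (simp add: free_vector_space_def)
  show "diffeological_smooth (free_vector_space X \<times> free_vector_space X)
     (prod_diffeology (coordinatewise_diffeology X) (coordinatewise_diffeology X))
     (free_vector_space X) (coordinatewise_diffeology X) (\<lambda>(v, w). v + w)"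
    unfolding diffeological_smooth_def
  proof (intro conjI allI impI)
    fix n U and p :: "(nat \<Rightarrow> real) \<Rightarrow> ('a \<Rightarrow>\<^sub>0 real) \<times> ('a \<Rightarrow>\<^sub>0 real)"
    assume "p \<in> prod_diffeology (coordinatewise_diffeology X) (coordinatewise_diffeology X) n U"
    then have p: "restrict (fst \<circ> p) U \<in> coordinatewise_diffeology X n U"
      "restrict (snd \<circ> p) U \<in> coordinatewise_diffeology X n U"
      by (auto simp: prod_diffeology_def)
    then have "continuous_map (subtopology (Euclidean_space n) U) euclideanreal
       (\<lambda>u. Poly_Mapping.lookup (restrict (fst \<circ> p) U u) x +
            Poly_Mapping.lookup (restrict (snd \<circ> p) U u) x)" for x
      by (intro continuous_map_add) (auto simp: coordinatewise_diffeology_def)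
    then have "continuous_map (subtopology (Euclidean_space n) U) euclideanreal
       (\<lambda>u. Poly_Mapping.lookup (restrict ((\<lambda>(v, w). v + w) \<circ> p) U u) x)" for x
      by (rule continuous_map_eq) (auto simp: lookup_add case_prod_beta)
    with p sub show "restrict ((\<lambda>(v, w). v + w) \<circ> p) U \<in> coordinatewise_diffeology X n U"
      by (auto simp: coordinatewise_diffeology_def case_prod_beta Pi_iff PiE_iff intro!: subspace_add)
  qed (use sub in \<open>auto intro: subspace_add\<close>)
  show "diffeological_smooth (UNIV \<times> free_vector_space X)
     (prod_diffeology real_diffeology (coordinatewise_diffeology X))
     (free_vector_space X) (coordinatewise_diffeology X) (\<lambda>(r, v). r *\<^sub>R v)"
    unfolding diffeological_smooth_def
  proof (intro conjI allI impI)
    fix n U and p :: "(nat \<Rightarrow> real) \<Rightarrow> real \<times> ('a \<Rightarrow>\<^sub>0 real)"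
    assume "p \<in> prod_diffeology real_diffeology (coordinatewise_diffeology X) n U"
    then have p: "smooth_function n U (restrict (fst \<circ> p) U)"
      "restrict (snd \<circ> p) U \<in> coordinatewise_diffeology X n U"
      by (auto simp: prod_diffeology_def real_diffeology_def)
    from p(2) have "continuous_map (subtopology (Euclidean_space n) U) euclideanreal
       (\<lambda>u. Poly_Mapping.lookup (restrict (snd \<circ> p) U u) x)" for x
      by (simp add: coordinatewise_diffeology_def)
    \<comment> \<open>Of the smooth scalar component only its continuity is kept.\<close>
    with smooth_function_imp_continuous_map[OF p(1)]
    have "continuous_map (subtopology (Euclidean_space n) U) euclideanreal
       (\<lambda>u. restrict (fst \<circ> p) U u * Poly_Mapping.lookup (restrict (snd \<circ> p) U u) x)" for x
      by (rule continuous_map_real_mult)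
    then have "continuous_map (subtopology (Euclidean_space n) U) euclideanreal
       (\<lambda>u. Poly_Mapping.lookup (restrict ((\<lambda>(r, v). r *\<^sub>R v) \<circ> p) U u) x)" for x
      by (rule continuous_map_eq) (auto simp: case_prod_beta lookup_scaleR)
    with p sub show "restrict ((\<lambda>(r, v). r *\<^sub>R v) \<circ> p) U \<in> coordinatewise_diffeology X n U"
      by (auto simp: coordinatewise_diffeology_def case_prod_beta Pi_iff PiE_iff intro!: subspace_scale)
  qed (use sub in \<open>auto intro: subspace_scale\<close>)
qed

section \<open>Plots of \<open>X\<close> as plots of \<open>F(X)\<close>\<close>

text \<open>The map factors as the smooth map \<open>u \<mapsto> (1, u)\<close> followed by the
  one-term generator \<open>(r, u) \<mapsto> r[p(u)]\<close>.\<close>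

lemma basis_plot_in_free_diffeology:
  assumes D: "diffeological_space X D" and p: "p \<in> D n U"
  shows "(\<lambda>u\<in>U. Poly_Mapping.single (p u) 1) \<in> free_diffeology X D n U"
proof -
  define k :: "nat \<Rightarrow> nat" where "k = (\<lambda>_. n)"
  define W where "W = free_domain 1 k (\<lambda>_. U)"
  define g where "g = (\<lambda>x\<in>W. \<Sum>i<1::nat.
    Poly_Mapping.single (p (block k i x)) (x (block_start k i)))"
  \<comment> \<open>This is \<open>u \<mapsto> (1, u)\<close>: coordinate 0 holds the scalar, and
    the coordinates of \<open>u\<close> move up by one.\<close>
  define f :: "(nat \<Rightarrow> real) \<Rightarrow> nat \<Rightarrow> real" where
    "f = (\<lambda>u j. if j = 0 then 1 else u (j - 1))"
  have U: "openin (Euclidean_space n) U"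
    using D p by (auto simp: diffeological_space_def)
  have zero: "u j = 0" if "u \<in> U" "n \<le> j" for u j
    using openin_subset[OF U] that by (auto simp: topspace_Euclidean_space)
  have g: "g \<in> free_generators D (Suc n) W"
    unfolding free_generators_def mem_Collect_eq
    by (intro exI[of _ 1] exI[of _ k] exI[of _ "\<lambda>_. U"] exI[of _ "\<lambda>_. p"])
      (use p in \<open>auto simp: W_def g_def k_def block_start_def\<close>)
  \<comment> \<open>\<open>block\<close> puts 0 from position \<open>n\<close> on, where a point of
    \<open>U\<close> is 0 anyway.\<close>
  have block: "block k 0 (f u) = u" if "u \<in> U" for u
    using zero[OF that] by (auto simp: block_def f_def k_def block_start_def not_less fun_eq_iff)
  have f_mem: "f u \<in> W" if "u \<in> U" for u
    using zero[OF that] block[OF that] that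
    by (auto simp: W_def free_domain_def block_start_def k_def topspace_Euclidean_space f_def)
  have "smooth_function n U (\<lambda>u. f u j)" for j
    unfolding smooth_function_def
    by (cases j) (auto simp: f_def Ck_function_const Ck_function_coordinate)
  then have f: "smooth_euclidean_map n U (Suc n) W f"
    using f_mem by (auto simp: smooth_euclidean_map_def)
  have "restrict (g \<circ> f) U = (\<lambda>u\<in>U. Poly_Mapping.single (p u) 1)"
  proof
    fix u
    have "f u (block_start k 0) = 1"
      by (simp add: f_def block_start_def)
    then show "restrict (g \<circ> f) U u = (\<lambda>u\<in>U. Poly_Mapping.single (p u) 1) u"
      using f_mem block by (simp add: g_def)
  qed
  \<comment> \<open>The generated diffeology is an infimum, so membership is checked in every
    diffeology \<open>E\<close> above the generators.\<close>
  moreover have "restrict (g \<circ> f) U \<in> E n U"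
    if E: "diffeological_space (free_vector_space X) E" "free_generators D \<le> E" for E
  proof -
    have "g \<in> E (Suc n) W"
      using le_funD[OF le_funD[OF E(2)]] g by (rule subsetD)
    then show ?thesis
      using E(1)[unfolded diffeological_space_def, THEN conjunct2, THEN conjunct2, THEN conjunct1] U f
      by simp
  qed
  ultimately show ?thesis
    by (auto simp: free_diffeology_def generated_diffeology_def)
qed

section \<open>Comparison with the discrete diffeology\<close>

text \<open>A locally constant map is glued, by the covering axiom, from constant maps, which are
  plots of any diffeology.\<close>

lemma discrete_diffeology_le:
  assumes D: "diffeological_space X D"
  shows "discrete_diffeology X \<le> D"
proof (intro le_funI subsetI)
  fix n U p
  assume p: "p \<in> discrete_diffeology X n U"
  \<comment> \<open>Members are nonempty so that the constant value is attained and hence lies in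
    \<open>X\<close>. For empty \<open>U\<close> the cover is empty.\<close>
  define \<U> where "\<U> = {V. openin (Euclidean_space n) V \<and> V \<subseteq> U \<and> V \<noteq> {} \<and> p constant_on V}"
  have Union: "\<Union>\<U> = U"
    using p by (fastforce simp: \<U>_def discrete_diffeology_def)
  have pX: "p \<in> U \<rightarrow>\<^sub>E X"
    using p by (simp add: discrete_diffeology_def)
  have opens: "openin (Euclidean_space n) V \<and> restrict p V \<in> D n V" if V: "V \<in> \<U>" for V
  proof -
    obtain v where v: "v \<in> V"
      using V by (auto simp: \<U>_def)
    then have "restrict p V = (\<lambda>u\<in>V. p v)" "p v \<in> X"
      using V pX by (auto simp: \<U>_def constant_on_def fun_eq_iff)
    then show ?thesis
      using D V by (auto simp: diffeological_space_def \<U>_def)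
  qed
  have "\<forall>n \<U> p. (\<forall>U\<in>\<U>. openin (Euclidean_space n) U \<and> restrict p U \<in> D n U) \<and>
      p \<in> \<Union>\<U> \<rightarrow>\<^sub>E X \<longrightarrow> p \<in> D n (\<Union>\<U>)"
    using D unfolding diffeological_space_def by (elim conjE)
  from this[rule_format, of \<U> n p] show "p \<in> D n U"
    using opens pX by (simp add: Union)
qed

lemma discrete_diffeology_if_basis_coordinatewise:
  assumes p: "p \<in> U \<rightarrow>\<^sub>E X"
    and single: "(\<lambda>u\<in>U. Poly_Mapping.single (p u) 1) \<in> coordinatewise_diffeology X n U"
  shows "p \<in> discrete_diffeology X n U"
proof -
  have U: "openin (Euclidean_space n) U"
    using single by (simp add: coordinatewise_diffeology_def)
  have fibre: "openin (Euclidean_space n) {u \<in> U. p u = x}" for x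
  proof -
    have "continuous_map (subtopology (Euclidean_space n) U) euclideanreal
        (\<lambda>u. Poly_Mapping.lookup ((\<lambda>u\<in>U. Poly_Mapping.single (p u) (1::real)) u) x)"
      using single by (simp add: coordinatewise_diffeology_def)
    \<comment> \<open>The coordinate at \<open>x\<close> takes only the values 1 and 0 on
      \<open>U\<close>, and the open half-line \<open>{0<..}\<close> contains just the
      first.\<close>
    from openin_continuous_map_preimage[OF this, of "{0<..}"]
    have "openin (subtopology (Euclidean_space n) U)
      {u \<in> topspace (subtopology (Euclidean_space n) U).
        Poly_Mapping.lookup ((\<lambda>u\<in>U. Poly_Mapping.single (p u) (1::real)) u) x \<in> {0<..}}"
      by simp
    also have "{u \<in> topspace (subtopology (Euclidean_space n) U).
        Poly_Mapping.lookup ((\<lambda>u\<in>U. Poly_Mapping.single (p u) (1::real)) u) x \<in> {0<..}}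
        = {u \<in> U. p u = x}"
      using openin_subset[OF U] by (auto simp: lookup_single when_def split: if_splits)
    finally show ?thesis
      using U openin_trans_full by blast
  qed
  have "\<exists>V. openin (Euclidean_space n) V \<and> u \<in> V \<and> V \<subseteq> U \<and> p constant_on V" if "u \<in> U" for u
    \<comment> \<open>The neighbourhood of \<open>u\<close> is the whole fibre of \<open>p\<close>
      through \<open>u\<close>.\<close>
    using that by (intro exI[of _ "{v \<in> U. p v = p u}"]) (auto simp: fibre constant_on_def)
  then show ?thesis
    using p U by (auto simp: discrete_diffeology_def)
qed

theorem theorem5p3:
  fixes X :: "'a set" and D :: "'a diffeology"
  assumes "diffeological_space X D"
    and "fine_vector_space (free_vector_space X) (free_diffeology X D)"
  shows "D = discrete_diffeology X"
proof (rule antisym)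
  have "free_diffeology X D \<le> coordinatewise_diffeology X"
    using assms(2) diffeological_vector_space_coordinatewise by (auto simp: fine_vector_space_def)
  then have "(\<lambda>u\<in>U. Poly_Mapping.single (p u) 1) \<in> coordinatewise_diffeology X n U"
    if "p \<in> D n U" for n U p
    using basis_plot_in_free_diffeology[OF assms(1) that] by (auto simp: le_fun_def)
  moreover have "p \<in> U \<rightarrow>\<^sub>E X" if "p \<in> D n U" for n U p
    using assms(1) that by (auto simp: diffeological_space_def)
  ultimately show "D \<le> discrete_diffeology X"
    by (intro le_funI subsetI discrete_diffeology_if_basis_coordinatewise)
qed (rule discrete_diffeology_le[OF assms(1)])

end
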